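(* Let $\mathcal{I}_1$ and $\mathcal{I}_2$ be finite implication algebras, with sets of minimal elements $M_{I_1}$, $M_{I_2}$, numbers of minimal elements $n(I_1)=|M_{I_1}|$, $n(I_2)=|M_{I_2}|$, and implication profiles $p_{I_1}$, $p_{I_2}$. Then $\mathcal{I}_1\cong\mathcal{I}_2$ if and only if $n(I_1)=n(I_2)$ and there is a bijection $\varphi\colon M_{I_1}\to M_{I_2}$ such that $p_{I_1}(X)=p_{I_2}(\varphi[X])$ for all nonempty $X\subseteq M_{I_1}$.
   Context: An implication algebra is a set $I$ with a binary operation $\to$ satisfying $(x\to y)\to x=x$, $(x\to y)\to y=(y\to x)\to x$ and $x\to(y\to z)=y\to(x\to z)$. Then $x\to x$ is a constant $\mathbf{1}$, and $x\le y$ iff $x\to y=\mathbf{1}$ is a partial order making $I$ a join-semilattice with top $\mathbf{1}$ in which every principal filter $[a,\mathbf{1}]$ is a Boolean algebra; equivalently, implication algebras are (up to isomorphism) the upward-closed subsets of Boolean algebras with $x\to y=\neg x\vee y$. Isomorphisms are bijections preserving $\to$ (equivalently, order-isomorphisms). For a finite implication algebra $\mathcal{I}$, $M_I$ denotes its set of minimal elements, $n(I)=|M_I|$, and the implication profile $p_I\colon \mathcal{P}(M_I)\setminus\{\emptyset\}\to\mathbb{N}$ is defined by $p_I(S)=k$ iff the interval $[\bigvee S,\mathbf{1}]$ is isomorphic to the Boolean algebra $2^k$ (i.e. $p_I(S)$ is the height of $[\bigvee S,\mathbf{1}]$). *)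

theory Defs
  imports "HOL-Algebra.Lattice"
begin

text \<open>
  The axioms do not force the carrier to be nonempty; the constant \<open>\<one>\<close> below is
  meaningful only when it is.
\<close>

locale implication_algebra =
  fixes A :: "'a set" and imp :: "'a \<Rightarrow> 'a \<Rightarrow> 'a"
  assumes imp_closed: "x \<in> A \<Longrightarrow> y \<in> A \<Longrightarrow> imp x y \<in> A"
    and imp_contract: "x \<in> A \<Longrightarrow> y \<in> A \<Longrightarrow> imp (imp x y) x = x"
    and imp_quasi_comm: "x \<in> A \<Longrightarrow> y \<in> A \<Longrightarrow> imp (imp x y) y = imp (imp y x) x"
    and imp_exchange:
      "x \<in> A \<Longrightarrow> y \<in> A \<Longrightarrow> z \<in> A \<Longrightarrow> imp x (imp y z) = imp y (imp x z)"

text \<open>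
  The constant \<open>\<one>\<close>, the common value of all \<open>x \<rightarrow> x\<close>.
\<close>

definition ia_one :: "'a set \<Rightarrow> ('a \<Rightarrow> 'a \<Rightarrow> 'a) \<Rightarrow> 'a" where
  "ia_one A imp = (THE e. \<forall>x\<in>A. imp x x = e)"

definition ia_order :: "'a set \<Rightarrow> ('a \<Rightarrow> 'a \<Rightarrow> 'a) \<Rightarrow> 'a gorder" where
  "ia_order A imp =
     \<lparr>carrier = A, eq = (=), le = (\<lambda>x y. imp x y = ia_one A imp)\<rparr>"

definition ia_iso ::
    "'a set \<Rightarrow> ('a \<Rightarrow> 'a \<Rightarrow> 'a) \<Rightarrow> 'b set \<Rightarrow> ('b \<Rightarrow> 'b \<Rightarrow> 'b) \<Rightarrow> bool" where
  "ia_iso A impA B impB \<longleftrightarrow>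
     (\<exists>f. bij_betw f A B \<and> (\<forall>x\<in>A. \<forall>y\<in>A. f (impA x y) = impB (f x) (f y)))"

definition order_isomorphic ::
    "('a, 'c) gorder_scheme \<Rightarrow> ('b, 'd) gorder_scheme \<Rightarrow> bool" where
  "order_isomorphic L K \<longleftrightarrow> (\<exists>f. bij_betw f (carrier L) (carrier K) \<and> order_emb L K f)"

text \<open>The Boolean algebra \<open>2^k\<close>, as the powerset of a \<open>k\<close>-element set.\<close>

definition bool_alg :: "nat \<Rightarrow> nat set gorder" where
  "bool_alg k = \<lparr>carrier = Pow {..<k}, eq = (=), le = (\<subseteq>)\<rparr>"

definition min_elems :: "'a set \<Rightarrow> ('a \<Rightarrow> 'a \<Rightarrow> 'a) \<Rightarrow> 'a set" where
  "min_elems A imp =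
     {m \<in> A. \<forall>x\<in>A. x \<sqsubseteq>\<^bsub>ia_order A imp\<^esub> m \<longrightarrow> x = m}"

definition num_min :: "'a set \<Rightarrow> ('a \<Rightarrow> 'a \<Rightarrow> 'a) \<Rightarrow> nat" where
  "num_min A imp = card (min_elems A imp)"

text \<open>
  The interval \<open>[\<Or>S, \<one>]\<close> carries the restriction of the order of the algebra.
  The profile is meaningful only for nonempty sets \<open>S\<close> of minimal elements.
\<close>

definition ia_profile :: "'a set \<Rightarrow> ('a \<Rightarrow> 'a \<Rightarrow> 'a) \<Rightarrow> 'a set \<Rightarrow> nat" where
  "ia_profile A imp S =
     (let L = ia_order A imp
      in THE k. order_isomorphic
                  (L\<lparr>carrier := \<lbrace>\<Squnion>\<^bsub>L\<^esub> S..ia_one A imp\<rbrace>\<^bsub>L\<^esub>\<rparr>) (bool_alg k))"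

end

theory Submission
  imports Defs
begin

text \<open>
  Sending an element \<open>x\<close> to the set \<open>c x\<close> of coatoms above it turns \<open>\<rightarrow>\<close> into a set difference,
  \<open>c (x \<rightarrow> y) = c y - c x\<close>, and identifies a finite implication algebra with a simplicial complex on
  its coatoms, ordered by reverse inclusion: the facets are the sets \<open>c m\<close> with \<open>m\<close> minimal, and a
  coatom \<open>d\<close> is removed from \<open>c x\<close> by passing to \<open>d \<rightarrow> x\<close>. Joins become intersections, so the profile
  of \<open>S\<close> is the cardinality of \<open>\<Inter>m\<in>S. c m\<close>. By inclusion-exclusion these cardinalities determine
  those of all cells of the Venn diagram of the facets, and matching cells of equal size yields
  a bijection of the coatoms that carries facets to facets, hence an isomorphism of complexes.
\<close>

section \<open>Order and coatoms\<close>

context implication_algebra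
begin

abbreviation one :: 'a (\<open>\<one>\<close>) where "\<one> \<equiv> ia_one A imp"

definition coatoms_above :: "'a \<Rightarrow> 'a set" where
  "coatoms_above x =
     {c \<in> A. c \<noteq> \<one> \<and> (\<forall>z\<in>A. imp c z = \<one> \<longrightarrow> z = c \<or> z = \<one>) \<and> imp x c = \<one>}"

section \<open>Arithmetic of the implication and its order\<close>

lemma imp_absorb: "x \<in> A \<Longrightarrow> y \<in> A \<Longrightarrow> imp x (imp x y) = imp x y"
  by (metis imp_closed imp_contract)

text \<open>With \<open>a = imp x y\<close>, absorption gives \<open>imp x a = a\<close> and
  contraction gives \<open>imp a x = x\<close>. Quasi-commutativity,
  \<open>imp (imp x a) a = imp (imp a x) x\<close>, then reads
  \<open>imp a a = imp x x\<close>.\<close>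

lemma imp_self_imp:
  assumes "x \<in> A" "y \<in> A"
  shows "imp (imp x y) (imp x y) = imp x x"
  using assms by (metis imp_absorb imp_closed imp_contract imp_quasi_comm)

text \<open>Two uses of \<open>imp_self_imp\<close> show that the join
  \<open>imp (imp x y) y\<close> has the same self-implication as \<open>x\<close>;
  quasi-commutativity makes the join symmetric, so it also has that of \<open>y\<close>.\<close>

lemma imp_self_eq: "x \<in> A \<Longrightarrow> y \<in> A \<Longrightarrow> imp x x = imp y y"
  by (metis imp_closed imp_quasi_comm imp_self_imp)

lemma imp_self: "x \<in> A \<Longrightarrow> imp x x = \<one>"
  unfolding ia_one_def by (rule the1I2) (auto intro: imp_self_eq)

lemma one_closed: "x \<in> A \<Longrightarrow> \<one> \<in> A"
  using imp_self imp_closed by metis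

lemma imp_one: "x \<in> A \<Longrightarrow> imp x \<one> = \<one>"
  by (metis imp_absorb imp_self)

lemma one_imp: "x \<in> A \<Longrightarrow> imp \<one> x = x"
  by (metis imp_contract imp_self)

lemma le_antisym: "x \<in> A \<Longrightarrow> y \<in> A \<Longrightarrow> imp x y = \<one> \<Longrightarrow> imp y x = \<one> \<Longrightarrow> x = y"
  by (metis imp_quasi_comm one_imp)

lemma le_imp: "x \<in> A \<Longrightarrow> y \<in> A \<Longrightarrow> imp y (imp x y) = \<one>"
  by (metis imp_exchange imp_one imp_self)

text \<open>For \<open>y\<close> below \<open>z\<close> the join of the two is \<open>z\<close>, so
  \<open>z = imp (imp z y) y\<close>. Exchange moves \<open>x\<close> inside and exhibits
  \<open>imp x z\<close> as an implication with conclusion \<open>imp x y\<close>, hence above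
  it.\<close>

lemma imp_mono:
  assumes "x \<in> A" "y \<in> A" "z \<in> A" "imp y z = \<one>"
  shows "imp (imp x y) (imp x z) = \<one>"
proof -
  have "z = imp (imp z y) y"
    using assms by (metis imp_quasi_comm one_imp)
  then have "imp x z = imp (imp z y) (imp x y)"
    using assms by (metis imp_closed imp_exchange)
  then show ?thesis
    using assms by (metis imp_closed le_imp)
qed

lemma le_trans:
  assumes "x \<in> A" "y \<in> A" "z \<in> A" "imp x y = \<one>" "imp y z = \<one>"
  shows "imp x z = \<one>"
  using assms by (metis imp_mono imp_closed one_imp)

text \<open>Exchange turns the claim into \<open>x\<close> being below
  \<open>imp (imp y z) z\<close>, and already the larger \<open>y\<close> is below that
  element.\<close>

lemma imp_antimono:
  assumes "x \<in> A" "y \<in> A" "z \<in> A" "imp x y = \<one>"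
  shows "imp (imp y z) (imp x z) = \<one>"
proof -
  have "imp y (imp (imp y z) z) = \<one>"
    using assms by (metis imp_closed imp_exchange imp_self)
  then have "imp x (imp (imp y z) z) = \<one>"
    using assms by (meson imp_closed le_trans)
  then show ?thesis
    using assms by (metis imp_closed imp_exchange)
qed

section \<open>Coatoms turn implication into set difference\<close>

lemma coatoms_above_closed: "coatoms_above x \<subseteq> A"
  by (auto simp: coatoms_above_def)

lemma coatoms_above_antimono:
  "x \<in> A \<Longrightarrow> y \<in> A \<Longrightarrow> imp x y = \<one> \<Longrightarrow> coatoms_above y \<subseteq> coatoms_above x"
  unfolding coatoms_above_def using le_trans by blast

text \<open>In a Boolean algebra \<open>imp x y\<close> is the join of \<open>y\<close> with the
  complement of \<open>x\<close>, and a coatom lies above exactly one of \<open>x\<close> and its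
  complement.\<close>

lemma coatoms_above_imp:
  assumes xy: "x \<in> A" "y \<in> A"
  shows "coatoms_above (imp x y) = coatoms_above y - coatoms_above x"
proof (intro equalityI subsetI)
  fix c assume c: "c \<in> coatoms_above (imp x y)"
  then have c': "c \<in> A" "c \<noteq> \<one>" "imp (imp x y) c = \<one>"
    by (auto simp: coatoms_above_def)
  have "c \<in> coatoms_above y"
    using c coatoms_above_antimono[OF xy(2) _ le_imp[OF xy]] xy imp_closed by blast
  moreover have False if "imp x c = \<one>"
  proof -
    \<comment> \<open>Contraction collapses the right-hand side to \<open>x\<close>, so the join of
      \<open>x\<close> and \<open>c\<close> is \<open>\<one>\<close>; since \<open>x\<close> is
      below \<open>c\<close>, that join is also \<open>c\<close>.\<close>
    have "imp (imp c x) (imp (imp x y) x) = \<one>"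
      using imp_antimono[OF imp_closed[OF xy] c'(1) xy(1) c'(3)] .
    then have "imp (imp c x) x = \<one>"
      using xy by (simp add: imp_contract)
    then have "c = \<one>"
      using that xy c' by (metis imp_quasi_comm one_imp)
    with c'(2) show False ..
  qed
  ultimately show "c \<in> coatoms_above y - coatoms_above x"
    by (auto simp: coatoms_above_def)
next
  fix c assume "c \<in> coatoms_above y - coatoms_above x"
  then have c: "c \<in> A" "c \<noteq> \<one>" "imp y c = \<one>" "imp x c \<noteq> \<one>"
    and max: "\<And>z. z \<in> A \<Longrightarrow> imp c z = \<one> \<Longrightarrow> z = c \<or> z = \<one>"
    by (auto simp: coatoms_above_def)
  \<comment> \<open>\<open>imp x c\<close> lies above the coatom \<open>c\<close> and differs from
    \<open>\<one>\<close>, which leaves only \<open>c\<close>.\<close>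
  have "imp x c = c"
    using max le_imp[OF xy(1) c(1)] c xy imp_closed by blast
  then have "imp (imp x y) c = \<one>"
    using imp_mono[OF xy c(1,3)] by simp
  then show "c \<in> coatoms_above (imp x y)"
    using c max by (auto simp: coatoms_above_def)
qed

lemma coatoms_above_coatom:
  "c \<in> coatoms_above x \<Longrightarrow> coatoms_above c = {c}"
  by (auto simp: coatoms_above_def imp_self)

end

section \<open>Finite algebras as simplicial complexes of coatom sets\<close>

locale finite_implication_algebra = implication_algebra +
  assumes finite_carrier: "finite A"
begin

lemma finite_coatoms_above: "finite (coatoms_above x)"
  using coatoms_above_closed finite_carrier finite_subset by blast

text \<open>Induction from the top downwards: passing to a strictly larger element strictly shrinks
  the principal filter, whose size serves as the measure.\<close>

lemma order_induct [consumes 1, case_names less]: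
  assumes "x \<in> A"
    and step: "\<And>x. x \<in> A \<Longrightarrow> (\<And>y. y \<in> A \<Longrightarrow> imp x y = \<one> \<Longrightarrow> y \<noteq> x \<Longrightarrow> P y) \<Longrightarrow> P x"
  shows "P x"
  using assms(1)
proof (induction "card {z \<in> A. imp x z = \<one>}" arbitrary: x rule: less_induct)
  case less
  show ?case
  proof (rule step[OF less.prems])
    fix y assume y: "y \<in> A" "imp x y = \<one>" "y \<noteq> x"
    have "{z \<in> A. imp y z = \<one>} \<subset> {z \<in> A. imp x z = \<one>}"
      using y less.prems le_trans le_antisym imp_self by blast
    then show "P y"
      using less.hyps y(1) finite_carrier by (simp add: psubset_card_mono)
  qed
qed

lemma coatoms_above_nonempty:
  assumes "x \<in> A" "x \<noteq> \<one>"
  shows "coatoms_above x \<noteq> {}"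
  using assms
proof (induction rule: order_induct)
  case (less x)
  show ?case
  proof (cases "\<exists>y\<in>A. imp x y = \<one> \<and> y \<noteq> x \<and> y \<noteq> \<one>")
    case True
    then show ?thesis
      using less coatoms_above_antimono by blast
  next
    case False
    then have "x \<in> coatoms_above x"
      using less.hyps less.prems by (auto simp: coatoms_above_def imp_self)
    then show ?thesis by blast
  qed
qed

text \<open>The inclusion says that \<open>imp x y\<close> has no coatom above it, and by
  \<open>coatoms_above_nonempty\<close> only \<open>\<one>\<close> has none.\<close>

lemma coatoms_above_subset_iff:
  assumes "x \<in> A" "y \<in> A"
  shows "coatoms_above y \<subseteq> coatoms_above x \<longleftrightarrow> imp x y = \<one>"
  using assms coatoms_above_imp coatoms_above_nonempty imp_closed coatoms_above_antimono
  by (metis Diff_eq_empty_iff)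

lemma inj_on_coatoms_above: "inj_on coatoms_above A"
  by (rule inj_onI) (metis coatoms_above_subset_iff le_antisym subset_refl)

lemma coatoms_above_downward_closed:
  assumes "x \<in> A" "T \<subseteq> coatoms_above x"
  obtains z where "z \<in> A" "coatoms_above z = T"
proof -
  \<comment> \<open>Coatoms are deleted one at a time; afterwards \<open>D\<close> is taken to be
    the complement of \<open>T\<close> in the face of \<open>x\<close>.\<close>
  have "\<exists>z\<in>A. coatoms_above z = coatoms_above x - D"
    if "finite D" "D \<subseteq> coatoms_above x" for D
    using that
  proof (induction D)
    case empty
    then show ?case using assms(1) by auto
  next
    case (insert d D)
    then obtain z where z: "z \<in> A" "coatoms_above z = coatoms_above x - D" by auto
    have "d \<in> A" "coatoms_above d = {d}"
      using insert.prems coatoms_above_closed coatoms_above_coatom by auto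
    then have "coatoms_above (imp d z) = coatoms_above x - insert d D"
      using z coatoms_above_imp by auto
    with \<open>d \<in> A\<close> z show ?case using imp_closed by blast
  qed
  from this[of "coatoms_above x - T"] obtain z
    where "z \<in> A" "coatoms_above z = coatoms_above x - (coatoms_above x - T)"
    using finite_coatoms_above by auto
  with assms(2) that show thesis by (simp add: double_diff)
qed

lemma min_elems_iff:
  "m \<in> min_elems A imp \<longleftrightarrow>
     m \<in> A \<and> (\<forall>x\<in>A. coatoms_above m \<subseteq> coatoms_above x \<longrightarrow> x = m)"
  by (auto simp: min_elems_def ia_order_def coatoms_above_subset_iff)

lemma min_elems_closed: "min_elems A imp \<subseteq> A"
  by (auto simp: min_elems_def)

text \<open>Every face lies in a facet, so the complex is determined by its facets.\<close>

lemma below_min_elem: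
  assumes "x \<in> A"
  obtains m where "m \<in> min_elems A imp" "coatoms_above x \<subseteq> coatoms_above m"
proof -
  have "finite (coatoms_above ` A)" "coatoms_above x \<in> coatoms_above ` A"
    using finite_carrier assms by auto
  then obtain T where T: "T \<in> coatoms_above ` A" "coatoms_above x \<subseteq> T"
    and max: "\<And>U. U \<in> coatoms_above ` A \<Longrightarrow> T \<subseteq> U \<Longrightarrow> U = T"
    by (metis finite_has_maximal2)
  from T(1) obtain m where m: "m \<in> A" "T = coatoms_above m" by blast
  then have "m \<in> min_elems A imp"
    using max inj_on_coatoms_above by (auto simp: min_elems_iff inj_on_def)
  with T(2) m(2) that show thesis by blast
qed

section \<open>The profile counts coatoms\<close>

text \<open>Supplies the order axioms that \<open>order_emb\<close> demands of the interval.\<close>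

lemma weak_partial_order_restrict:
  assumes "B \<subseteq> A"
  shows "weak_partial_order ((ia_order A imp)\<lparr>carrier := B\<rparr>)"
  using assms
  by unfold_locales (auto simp: ia_order_def imp_self dest: le_antisym le_trans)

text \<open>The interval above the join of \<open>S\<close> consists of all faces contained in the
  common intersection \<open>?T\<close> of the facets, so it is a copy of \<open>Pow ?T\<close> with
  reversed order.\<close>

lemma profile_eq_card:
  assumes S: "S \<subseteq> min_elems A imp" "S \<noteq> {}"
  shows "ia_profile A imp S = card (\<Inter>m\<in>S. coatoms_above m)"
proof -
  let ?L = "ia_order A imp" and ?T = "\<Inter>m\<in>S. coatoms_above m"
  have SA: "S \<subseteq> A" using S(1) min_elems_closed by blast
  have finT: "finite ?T" using S(2) finite_coatoms_above by blast
  obtain m where m: "m \<in> S" using S(2) by blast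
  then have "?T \<subseteq> coatoms_above m" by blast
  \<comment> \<open>\<open>?T\<close> is part of a single facet, hence itself a face; its element
    \<open>j\<close> turns out to be the join of \<open>S\<close>.\<close>
  then obtain j where j: "j \<in> A" "coatoms_above j = ?T"
    using coatoms_above_downward_closed m SA by blast
  have Upper: "Upper ?L S = {u \<in> A. coatoms_above u \<subseteq> ?T}"
    using SA coatoms_above_subset_iff by (fastforce simp: Upper_def ia_order_def)
  have least: "least ?L x (Upper ?L S) \<longleftrightarrow> x = j" for x
  proof
    assume "least ?L x (Upper ?L S)"
    then have "x \<in> A" "coatoms_above x \<subseteq> ?T" "imp x j = \<one>"
      using j unfolding least_def Upper by (auto simp: ia_order_def)
    then show "x = j"
      using j coatoms_above_subset_iff le_antisym by metis
  next
    assume "x = j"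
    then show "least ?L x (Upper ?L S)"
      using j coatoms_above_subset_iff[OF j(1)] unfolding least_def Upper by (auto simp: ia_order_def)
  qed
  have sup: "\<Squnion>\<^bsub>?L\<^esub> S = j"
    by (simp add: Lattice.sup_def least)
  define B where "B = {x \<in> A. imp j x = \<one>}"
  have B: "\<lbrace>\<Squnion>\<^bsub>?L\<^esub> S..\<one>\<rbrace>\<^bsub>?L\<^esub> = B"
    by (auto simp: at_least_at_most_def ia_order_def sup B_def imp_one sup[unfolded ia_order_def])
  have bijB: "bij_betw coatoms_above B (Pow ?T)"
    unfolding bij_betw_def
  proof
    show "inj_on coatoms_above B"
      using inj_on_coatoms_above by (rule inj_on_subset) (auto simp: B_def)
    show "coatoms_above ` B = Pow ?T"
    proof (intro equalityI subsetI)
      fix U assume "U \<in> Pow ?T"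
      then have "U \<subseteq> coatoms_above j" using j(2) by simp
      with j(1) obtain z where "z \<in> A" "coatoms_above z = U"
        by (rule coatoms_above_downward_closed)
      with \<open>U \<in> Pow ?T\<close> show "U \<in> coatoms_above ` B"
        using j coatoms_above_subset_iff[of j z] by (auto simp: B_def)
    qed (use j coatoms_above_subset_iff in \<open>auto simp: B_def\<close>)
  qed
  obtain h where h: "bij_betw h ?T {..<card ?T}"
    using ex_bij_betw_finite_nat[OF finT] by (auto simp: atLeast0LessThan)
  \<comment> \<open>Complementing within \<open>?T\<close> undoes the order reversal, and
    \<open>h\<close> renames the coatoms to the numbers used by \<open>bool_alg\<close>.\<close>
  let ?f = "\<lambda>x. h ` (?T - coatoms_above x)"
  have "bij_betw (\<lambda>U. ?T - U) (Pow ?T) (Pow ?T)"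
    by (rule bij_betw_byWitness[where f' = "\<lambda>U. ?T - U"]) blast+
  from bij_betw_trans[OF bij_betw_trans[OF bijB this] bij_betw_Pow[OF h]]
  have f: "bij_betw ?f B (Pow {..<card ?T})"
    by (simp add: comp_def)
  have f_le: "?f x \<subseteq> ?f y \<longleftrightarrow> imp x y = \<one>" if "x \<in> B" "y \<in> B" for x y
  proof -
    have sub: "coatoms_above x \<subseteq> ?T" "coatoms_above y \<subseteq> ?T"
      using that bijB by (auto simp: bij_betw_def)
    have "?f x \<subseteq> ?f y \<longleftrightarrow> ?T - coatoms_above x \<subseteq> ?T - coatoms_above y"
      using h by (auto simp: bij_betw_def inj_on_image_mem_iff image_subset_iff)
    also have "\<dots> \<longleftrightarrow> coatoms_above y \<subseteq> coatoms_above x"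
      using sub by blast
    also have "\<dots> \<longleftrightarrow> imp x y = \<one>"
      using that by (intro coatoms_above_subset_iff) (auto simp: B_def)
    finally show ?thesis .
  qed
  have wpo: "weak_partial_order (bool_alg k)" for k
    by unfold_locales (auto simp: bool_alg_def)
  have "order_emb (?L\<lparr>carrier := B\<rparr>) (bool_alg (card ?T)) ?f"
    unfolding order_emb_def
    using weak_partial_order_restrict[of B] wpo f_le
    by (auto simp: B_def) (auto simp: ia_order_def bool_alg_def)
  then have ex: "order_isomorphic (?L\<lparr>carrier := B\<rparr>) (bool_alg (card ?T))"
    unfolding order_isomorphic_def using f by (auto simp: bool_alg_def)
  \<comment> \<open>The description \<open>THE k\<close> also needs uniqueness, for which comparing
    the sizes \<open>2 ^ k\<close> suffices.\<close>
  have "k = card ?T" if iso: "order_isomorphic (?L\<lparr>carrier := B\<rparr>) (bool_alg k)" for k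
  proof -
    from iso obtain g where "bij_betw g B (Pow {..<k})"
      by (auto simp: order_isomorphic_def bool_alg_def)
    then have "card (Pow {..<k}) = card (Pow {..<card ?T})"
      using f bij_betw_same_card by metis
    then show ?thesis by (simp add: card_Pow)
  qed
  with ex have "(THE k. order_isomorphic (?L\<lparr>carrier := B\<rparr>) (bool_alg k)) = card ?T"
    by (rule the_equality)
  then show ?thesis
    by (simp only: ia_profile_def Let_def B)
qed

end

section \<open>Matching Venn diagrams\<close>

text \<open>Fibres over the same label are matched separately. The pieces glue to a bijection
  because \<open>h\<close> preserves labels, so points of different fibres never collide.\<close>

lemma card_fibres_eq_imp_bij:
  assumes "finite V" "finite W"
    and card: "\<And>s. card {v \<in> V. t v = s} = card {w \<in> W. u w = s}"
  obtains h where "bij_betw h V W" "\<And>v. v \<in> V \<Longrightarrow> u (h v) = t v"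
proof -
  have "\<exists>g. bij_betw g {v \<in> V. t v = s} {w \<in> W. u w = s}" for s
    using assms by (intro finite_same_card_bij) auto
  then obtain g where g: "\<And>s. bij_betw (g s) {v \<in> V. t v = s} {w \<in> W. u w = s}"
    by metis
  define h where "h v = g (t v) v" for v
  have h: "h v \<in> W" "u (h v) = t v" if "v \<in> V" for v
    using g[of "t v"] that by (auto simp: h_def bij_betw_def)
  have "inj_on h V"
  proof (rule inj_onI)
    fix v v' assume v: "v \<in> V" "v' \<in> V" and eq: "h v = h v'"
    then have "t v = t v'" using h by metis
    with v eq g[of "t v"] show "v = v'"
      by (auto simp: h_def bij_betw_def inj_on_def)
  qed
  moreover have "h ` V = W"
  proof
    show "W \<subseteq> h ` V"
    proof
      fix w assume "w \<in> W"
      then obtain v where "v \<in> V" "t v = u w" "w = g (u w) v"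
        using g[of "u w"] by (auto simp: bij_betw_def)
      then have "v \<in> V" "w = h v" by (simp_all add: h_def)
      then show "w \<in> h ` V" by blast
    qed
  qed (use h in blast)
  ultimately show thesis
    using that h by (auto simp: bij_betw_def)
qed

text \<open>The cell of \<open>R\<close> holds the points that lie in \<open>F m\<close> for exactly
  the \<open>m\<close> in \<open>R\<close>; an intersection over \<open>S\<close> is the disjoint
  union of the cells with \<open>R\<close> containing \<open>S\<close>. Nonemptiness of
  \<open>S\<close> keeps every such cell inside some \<open>F m\<close>, hence finite. The cell of
  \<open>S\<close> is split off for the recursion that follows.\<close>

lemma card_Inter_eq_sum_cells:
  assumes fin: "finite M" "\<And>m. m \<in> M \<Longrightarrow> finite (F m)"
    and S: "S \<subseteq> M" "S \<noteq> {}"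
  shows "card (\<Inter>m\<in>S. F m) = card {v. {m \<in> M. v \<in> F m} = S} +
    (\<Sum>R | S \<subset> R \<and> R \<subseteq> M. card {v. {m \<in> M. v \<in> F m} = R})"
proof -
  let ?cell = "\<lambda>R. {v. {m \<in> M. v \<in> F m} = R}" and ?Q = "{R. S \<subset> R \<and> R \<subseteq> M}"
  have finQ: "finite ?Q"
    using fin(1) by (auto intro: finite_subset[of _ "Pow M"])
  have fin_cell: "finite (?cell R)" if "R \<in> insert S ?Q" for R
  proof -
    from that S obtain m where "m \<in> R" "m \<in> M" by blast
    then have "?cell R \<subseteq> F m" by blast
    with fin(2) \<open>m \<in> M\<close> show ?thesis by (meson finite_subset)
  qed
  have "(\<Inter>m\<in>S. F m) = (\<Union>R\<in>insert S ?Q. ?cell R)"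
  proof (intro equalityI subsetI)
    fix v assume "v \<in> (\<Inter>m\<in>S. F m)"
    then have "{m \<in> M. v \<in> F m} \<in> insert S ?Q" using S(1) by blast
    then show "v \<in> (\<Union>R\<in>insert S ?Q. ?cell R)" by blast
  qed blast
  also have "card \<dots> = (\<Sum>R\<in>insert S ?Q. card (?cell R))"
    using finQ fin_cell by (intro card_UN_disjoint) auto
  finally show ?thesis
    using finQ by simp
qed

text \<open>Inclusion-exclusion in recursive form: going down from \<open>S = M\<close>, the larger
  cells already agree and cancel from the two expansions of the same intersection size.\<close>

lemma card_cells_eq:
  assumes fin: "finite M" "\<And>m. m \<in> M \<Longrightarrow> finite (F m)" "\<And>m. m \<in> M \<Longrightarrow> finite (G m)"
    and card: "\<And>X. X \<subseteq> M \<Longrightarrow> X \<noteq> {} \<Longrightarrow> card (\<Inter>m\<in>X. F m) = card (\<Inter>m\<in>X. G m)"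
    and S: "S \<subseteq> M" "S \<noteq> {}"
  shows "card {v. {m \<in> M. v \<in> F m} = S} = card {w. {m \<in> M. w \<in> G m} = S}"
  using S
proof (induction "card (M - S)" arbitrary: S rule: less_induct)
  case less
  define Q where "Q = {R. S \<subset> R \<and> R \<subseteq> M}"
  have "card {v. {m \<in> M. v \<in> F m} = R} = card {w. {m \<in> M. w \<in> G m} = R}" if "R \<in> Q" for R
  proof (rule less.hyps)
    show "card (M - R) < card (M - S)"
      using that fin(1) by (intro psubset_card_mono) (auto simp: Q_def)
  qed (use that in \<open>auto simp: Q_def\<close>)
  then have "(\<Sum>R\<in>Q. card {v. {m \<in> M. v \<in> F m} = R}) = (\<Sum>R\<in>Q. card {w. {m \<in> M. w \<in> G m} = R})"
    by (rule sum.cong[OF refl])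
  then show ?case
    using card_Inter_eq_sum_cells[OF fin(1,2) less.prems] card_Inter_eq_sum_cells[OF fin(1,3) less.prems]
      card[OF less.prems] unfolding Q_def by simp
qed

lemma card_Inter_eq_imp_bij:
  assumes fin: "finite M" "\<And>m. m \<in> M \<Longrightarrow> finite (F m)" "\<And>m. m \<in> M \<Longrightarrow> finite (G m)"
    and card: "\<And>X. X \<subseteq> M \<Longrightarrow> X \<noteq> {} \<Longrightarrow> card (\<Inter>m\<in>X. F m) = card (\<Inter>m\<in>X. G m)"
  obtains h where "inj_on h (\<Union>m\<in>M. F m)" "\<And>m. m \<in> M \<Longrightarrow> h ` F m = G m"
proof -
  have "card {v \<in> (\<Union>m\<in>M. F m). {m \<in> M. v \<in> F m} = S} =
        card {w \<in> (\<Union>m\<in>M. G m). {m \<in> M. w \<in> G m} = S}" for S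
  \<comment> \<open>Points of the unions carry only nonempty subsets of \<open>M\<close> as labels;
    every other label has an empty fibre on both sides.\<close>
  proof (cases "S \<subseteq> M \<and> S \<noteq> {}")
    case True
    then have "{v \<in> (\<Union>m\<in>M. F m). {m \<in> M. v \<in> F m} = S} = {v. {m \<in> M. v \<in> F m} = S}"
      "{w \<in> (\<Union>m\<in>M. G m). {m \<in> M. w \<in> G m} = S} = {w. {m \<in> M. w \<in> G m} = S}"
      by blast+
    then show ?thesis
      using card_cells_eq[OF fin card, of S] True by metis
  next
    case False
    then have "{v \<in> (\<Union>m\<in>M. F m). {m \<in> M. v \<in> F m} = S} = {}"
      "{w \<in> (\<Union>m\<in>M. G m). {m \<in> M. w \<in> G m} = S} = {}"
      by blast+
    then show ?thesis by (metis card.empty)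
  qed
  then obtain h where h: "bij_betw h (\<Union>m\<in>M. F m) (\<Union>m\<in>M. G m)"
    and cell: "\<And>v. v \<in> (\<Union>m\<in>M. F m) \<Longrightarrow> {m \<in> M. h v \<in> G m} = {m \<in> M. v \<in> F m}"
    using card_fibres_eq_imp_bij[of "\<Union>m\<in>M. F m" "\<Union>m\<in>M. G m"
        "\<lambda>v. {m \<in> M. v \<in> F m}" "\<lambda>w. {m \<in> M. w \<in> G m}"] fin by auto
  have "h ` F m = G m" if m: "m \<in> M" for m
  proof (intro equalityI subsetI)
    fix w assume "w \<in> G m"
    then obtain v where "v \<in> (\<Union>m\<in>M. F m)" "w = h v"
      using bij_betw_imp_surj_on[OF h] m by blast
    with \<open>w \<in> G m\<close> cell[of v] m show "w \<in> h ` F m" by blast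
  qed (use cell m in blast)
  with h that show thesis by (auto simp: bij_betw_def)
qed

section \<open>Isomorphisms\<close>

locale two_finite_implication_algebras =
  L: finite_implication_algebra A impA + R: finite_implication_algebra B impB
  for A :: "'a set" and impA and B :: "'b set" and impB
begin

lemma iso_imp_profile_eq:
  assumes f: "bij_betw f A B" and hom: "\<And>x y. x \<in> A \<Longrightarrow> y \<in> A \<Longrightarrow> f (impA x y) = impB (f x) (f y)"
  shows "bij_betw f (min_elems A impA) (min_elems B impB)"
    and "X \<subseteq> min_elems A impA \<Longrightarrow> X \<noteq> {} \<Longrightarrow> ia_profile A impA X = ia_profile B impB (f ` X)"
proof -
  have inj: "inj_on f A" and im: "f ` A = B" using f by (auto simp: bij_betw_def)
  \<comment> \<open>On an empty carrier \<open>ia_one\<close> is unspecified, so an element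
    \<open>x\<close> must witness that the constant is meaningful.\<close>
  have one: "f (ia_one A impA) = ia_one B impB" if "x \<in> A" for x
    using that hom L.imp_self R.imp_self im by (metis image_eqI)
  have le: "impB (f x) (f y) = ia_one B impB \<longleftrightarrow> impA x y = ia_one A impA"
    if "x \<in> A" "y \<in> A" for x y
    using that hom one inj L.imp_closed L.one_closed by (metis inj_on_eq_iff)
  have coatoms: "R.coatoms_above (f x) = f ` L.coatoms_above x" if x: "x \<in> A" for x
  proof -
    have "f c \<in> R.coatoms_above (f x) \<longleftrightarrow> c \<in> L.coatoms_above x" if c: "c \<in> A" for c
    proof -
      have "f z = ia_one B impB \<longleftrightarrow> z = ia_one A impA" "f z = f c \<longleftrightarrow> z = c" if "z \<in> A" for z
        using that one[OF x] inj L.one_closed[OF x] c by (metis inj_on_eq_iff)+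
      moreover have "f c \<in> B" using c im by blast
      moreover have "(\<forall>z\<in>B. P z) \<longleftrightarrow> (\<forall>z\<in>A. P (f z))" for P using im by blast
      ultimately show ?thesis
        using c x by (simp add: R.coatoms_above_def L.coatoms_above_def le)
    qed
    then show ?thesis
      using im R.coatoms_above_closed L.coatoms_above_closed by blast
  qed
  have minimal: "f m \<in> min_elems B impB \<longleftrightarrow> m \<in> min_elems A impA" if "m \<in> A" for m
  proof -
    have "f x = f m \<longleftrightarrow> x = m" if "x \<in> A" for x
      using that \<open>m \<in> A\<close> inj by (meson inj_on_eq_iff)
    moreover have "f m \<in> B" using that im by blast
    moreover have "(\<forall>z\<in>B. P z) \<longleftrightarrow> (\<forall>x\<in>A. P (f x))" for P using im by blast
    ultimately show ?thesis
      using that by (simp add: min_elems_def ia_order_def le)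
  qed
  show bij_min: "bij_betw f (min_elems A impA) (min_elems B impB)"
    unfolding bij_betw_def
  proof
    show "inj_on f (min_elems A impA)"
      using inj L.min_elems_closed by (rule inj_on_subset)
    show "f ` min_elems A impA = min_elems B impB"
      using im minimal L.min_elems_closed R.min_elems_closed by blast
  qed
  assume X: "X \<subseteq> min_elems A impA" "X \<noteq> {}"
  then have XA: "X \<subseteq> A" using L.min_elems_closed by blast
  obtain m\<^sub>0 where m\<^sub>0: "m\<^sub>0 \<in> X" using X(2) by blast
  \<comment> \<open>Images commute with intersections because \<open>f\<close> is injective on
    \<open>A\<close> and the index set contains \<open>m\<^sub>0\<close>.\<close>
  have "f ` (\<Inter>m\<in>X. L.coatoms_above m) = (\<Inter>m\<in>X. f ` L.coatoms_above m)"
    by (rule image_INT[OF inj _ m\<^sub>0]) (simp add: L.coatoms_above_closed)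
  also have "\<dots> = (\<Inter>m\<in>f ` X. R.coatoms_above m)"
    using coatoms XA by (auto simp: subset_iff)
  finally have "card (\<Inter>m\<in>f ` X. R.coatoms_above m) = card (f ` (\<Inter>m\<in>X. L.coatoms_above m))"
    by simp
  also have "\<dots> = card (\<Inter>m\<in>X. L.coatoms_above m)"
    using m\<^sub>0 L.coatoms_above_closed by (intro card_image inj_on_subset[OF inj]) blast
  finally show "ia_profile A impA X = ia_profile B impB (f ` X)"
    using L.profile_eq_card[OF X] R.profile_eq_card[of "f ` X"] X bij_betw_imp_surj_on[OF bij_min]
    by (metis image_is_empty image_mono)
qed

text \<open>Reindexing the facets of \<open>B\<close> along \<open>\<phi>\<close> gives two families
  over the same index set with equal intersection sizes, so \<open>card_Inter_eq_imp_bij\<close>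
  yields a matching \<open>h\<close> of the coatoms. The isomorphism sends \<open>x\<close> to the
  element whose face is the \<open>h\<close>-image of the face of \<open>x\<close>.\<close>

lemma profile_eq_imp_iso:
  assumes \<phi>: "bij_betw \<phi> (min_elems A impA) (min_elems B impB)"
    and profile: "\<And>X. X \<subseteq> min_elems A impA \<Longrightarrow> X \<noteq> {} \<Longrightarrow>
      ia_profile A impA X = ia_profile B impB (\<phi> ` X)"
  shows "ia_iso A impA B impB"
proof -
  let ?M = "min_elems A impA"
  have card: "card (\<Inter>m\<in>X. L.coatoms_above m) = card (\<Inter>m\<in>X. R.coatoms_above (\<phi> m))"
    if X: "X \<subseteq> ?M" "X \<noteq> {}" for X
  proof -
    have "\<phi> ` X \<subseteq> min_elems B impB" using X \<phi> by (auto simp: bij_betw_def)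
    then show ?thesis
      using L.profile_eq_card[OF X] R.profile_eq_card[of "\<phi> ` X"] profile[OF X] X(2) by simp
  qed
  have "finite ?M" using L.min_elems_closed L.finite_carrier finite_subset by blast
  then obtain h where h: "inj_on h (\<Union>m\<in>?M. L.coatoms_above m)"
    and facet: "\<And>m. m \<in> ?M \<Longrightarrow> h ` L.coatoms_above m = R.coatoms_above (\<phi> m)"
    using card_Inter_eq_imp_bij[of ?M L.coatoms_above "\<lambda>m. R.coatoms_above (\<phi> m)"]
      L.finite_coatoms_above R.finite_coatoms_above card by blast
  have sub: "L.coatoms_above x \<subseteq> (\<Union>m\<in>?M. L.coatoms_above m)" if "x \<in> A" for x
    using L.below_min_elem[OF that] by blast
  \<comment> \<open>The image of a face lies in the image of a facet, which is a facet of
    \<open>B\<close>, and is therefore a face.\<close>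
  have ex: "\<exists>z\<in>B. R.coatoms_above z = h ` L.coatoms_above x" if x: "x \<in> A" for x
  proof -
    obtain m where m: "m \<in> ?M" "L.coatoms_above x \<subseteq> L.coatoms_above m"
      using L.below_min_elem[OF x] .
    then have "h ` L.coatoms_above x \<subseteq> R.coatoms_above (\<phi> m)"
      using facet by blast
    moreover have "\<phi> m \<in> B"
      using m(1) \<phi> R.min_elems_closed by (auto simp: bij_betw_def)
    ultimately show ?thesis
      using R.coatoms_above_downward_closed by metis
  qed
  then obtain f where f: "\<And>x. x \<in> A \<Longrightarrow> f x \<in> B"
    and coatoms: "\<And>x. x \<in> A \<Longrightarrow> R.coatoms_above (f x) = h ` L.coatoms_above x"
    by metis
  have "inj_on f A"
  proof (rule inj_onI)
    fix x y assume xy: "x \<in> A" "y \<in> A" "f x = f y"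
    then have "h ` L.coatoms_above x = h ` L.coatoms_above y"
      using coatoms by metis
    then have "L.coatoms_above x = L.coatoms_above y"
      using inj_on_image_eq_iff[OF h sub[OF xy(1)] sub[OF xy(2)]] by simp
    then show "x = y"
      using L.inj_on_coatoms_above xy by (auto dest: inj_onD)
  qed
  moreover have "f ` A = B"
  proof (intro equalityI subsetI)
    fix z assume z: "z \<in> B"
    then obtain n where n: "n \<in> min_elems B impB" "R.coatoms_above z \<subseteq> R.coatoms_above n"
      using R.below_min_elem by blast
    \<comment> \<open>Surjectivity: the face of \<open>z\<close> sits in the facet of
      \<open>\<phi> m\<close>, so it pulls back along \<open>h\<close> to a subset \<open>T\<close>
      of the facet of \<open>m\<close>, again a face.\<close>
    then obtain m where m: "m \<in> ?M" "n = \<phi> m" using \<phi> by (auto simp: bij_betw_def)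
    then have "R.coatoms_above z \<subseteq> h ` L.coatoms_above m" using n facet by simp
    then obtain T where T: "T \<subseteq> L.coatoms_above m" "R.coatoms_above z = h ` T"
      by (auto simp: subset_image_iff)
    then obtain x where x: "x \<in> A" "L.coatoms_above x = T"
      using L.coatoms_above_downward_closed m(1) L.min_elems_closed by blast
    then have "f x = z"
      using T z f coatoms R.inj_on_coatoms_above by (auto intro: inj_onD)
    with x show "z \<in> f ` A" by blast
  qed (use f in blast)
  moreover have "f (impA x y) = impB (f x) (f y)" if xy: "x \<in> A" "y \<in> A" for x y
  proof (rule inj_onD[OF R.inj_on_coatoms_above])
    have "R.coatoms_above (f (impA x y)) = h ` (L.coatoms_above y - L.coatoms_above x)"
      using xy by (simp add: coatoms L.imp_closed L.coatoms_above_imp)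
    \<comment> \<open>Injectivity of \<open>h\<close> is what lets the image pass through the set
      difference that encodes \<open>imp\<close>.\<close>
    also have "\<dots> = h ` L.coatoms_above y - h ` L.coatoms_above x"
      using sub[OF xy(1)] sub[OF xy(2)] by (intro inj_on_image_set_diff[OF h]) blast+
    also have "\<dots> = R.coatoms_above (impB (f x) (f y))"
      using xy f by (simp add: coatoms R.coatoms_above_imp)
    finally show "R.coatoms_above (f (impA x y)) = R.coatoms_above (impB (f x) (f y))" .
  qed (use xy f L.imp_closed R.imp_closed in auto)
  ultimately show ?thesis
    unfolding ia_iso_def bij_betw_def by blast
qed

end

theorem theorem2p2:
  fixes I1 :: "'a set" and imp1 :: "'a \<Rightarrow> 'a \<Rightarrow> 'a"
    and I2 :: "'b set" and imp2 :: "'b \<Rightarrow> 'b \<Rightarrow> 'b"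
  assumes "implication_algebra I1 imp1" and "finite I1"
    and "implication_algebra I2 imp2" and "finite I2"
  shows "ia_iso I1 imp1 I2 imp2 \<longleftrightarrow>
    num_min I1 imp1 = num_min I2 imp2 \<and>
    (\<exists>\<phi>. bij_betw \<phi> (min_elems I1 imp1) (min_elems I2 imp2) \<and>
      (\<forall>X. X \<subseteq> min_elems I1 imp1 \<and> X \<noteq> {} \<longrightarrow>
        ia_profile I1 imp1 X = ia_profile I2 imp2 (\<phi> ` X)))"
    (is "?iso \<longleftrightarrow> ?num \<and> ?profile")
proof -
  interpret two_finite_implication_algebras I1 imp1 I2 imp2
    using assms
    by (simp add: two_finite_implication_algebras_def finite_implication_algebra_def
        finite_implication_algebra_axioms_def)
  have "?iso \<Longrightarrow> ?profile"
    unfolding ia_iso_def using iso_imp_profile_eq by blast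
  moreover have "?profile \<Longrightarrow> ?num"
    unfolding num_min_def by (meson bij_betw_same_card)
  moreover have "?profile \<Longrightarrow> ?iso"
    using profile_eq_imp_iso by blast
  ultimately show ?thesis by blast
qed

end
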